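(* Let $L$ be a finite-dimensional solvable Lie algebra over an arbitrary field $F$. Then $\delta(L)$ (and hence also $\eta(L)$) is supersolvable.
   Context: For $x \in L$, the Engel subalgebra $E_L(x)$ is the Fitting null-component of $L$ relative to $\mathrm{ad}\,x$, i.e. $E_L(x) = \{y \in L : (\mathrm{ad}\,x)^n(y) = 0 \text{ for some } n\}$. For a subalgebra $U$ of $L$, the core $U_L$ is the largest ideal of $L$ contained in $U$. Let $\mathcal{G}_L$ be the set of all maximal subalgebras $M$ of $L$ such that $E_L(x) \subseteq M$ for some $x \in L$. Let $\mathcal{H}_L$ be the set of all maximal subalgebras of $L$ of codimension greater than $1$ in $L$, and let $\mathcal{D}_L = \mathcal{G}_L \cap \mathcal{H}_L$. Put $H(L) = \bigcap_{M \in \mathcal{H}_L} M$ if $\mathcal{H}_L \neq \emptyset$ and $H(L) = L$ otherwise, and $\eta(L) = H(L)_L$. Put $D(L) = \bigcap_{M \in \mathcal{D}_L} M$ if $\mathcal{D}_L \neq \emptyset$ and $D(L) = L$ otherwise, and $\delta(L) = D(L)_L$. *)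

theory Defs
  imports Complex_Main
begin

text \<open>
  A Lie algebra over an arbitrary field: \<open>L\<close> is a subspace of some ambient vector space and the
  bracket is only constrained on \<open>L\<close>. Carrying \<open>L\<close> explicitly lets the same notions be applied to
  subalgebras of \<open>L\<close> with the restricted bracket. The bracket is alternating, which in
  characteristic 2 is stronger than anticommutative.
\<close>

locale lie_algebra = vector_space scale
  for scale :: "'f::field \<Rightarrow> 'v::ab_group_add \<Rightarrow> 'v"  (infixr "*s" 75) +
  fixes L :: "'v set"
    and bracket :: "'v \<Rightarrow> 'v \<Rightarrow> 'v"
  assumes subspace_carrier: "subspace L"
    and bracket_closed: "\<lbrakk>x \<in> L; y \<in> L\<rbrakk> \<Longrightarrow> bracket x y \<in> L"
    and bracket_add_left:
      "\<lbrakk>x \<in> L; y \<in> L; z \<in> L\<rbrakk> \<Longrightarrow> bracket (x + y) z = bracket x z + bracket y z"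
    and bracket_add_right:
      "\<lbrakk>x \<in> L; y \<in> L; z \<in> L\<rbrakk> \<Longrightarrow> bracket x (y + z) = bracket x y + bracket x z"
    and bracket_scale_left: "\<lbrakk>x \<in> L; y \<in> L\<rbrakk> \<Longrightarrow> bracket (c *s x) y = c *s bracket x y"
    and bracket_scale_right: "\<lbrakk>x \<in> L; y \<in> L\<rbrakk> \<Longrightarrow> bracket x (c *s y) = c *s bracket x y"
    and bracket_self: "x \<in> L \<Longrightarrow> bracket x x = 0"
    and jacobi: "\<lbrakk>x \<in> L; y \<in> L; z \<in> L\<rbrakk> \<Longrightarrow>
      bracket x (bracket y z) + bracket y (bracket z x) + bracket z (bracket x y) = 0"
begin

definition subalgebra :: "'v set \<Rightarrow> bool" where
  "subalgebra U \<longleftrightarrow> subspace U \<and> U \<subseteq> L \<and> (\<forall>x\<in>U. \<forall>y\<in>U. bracket x y \<in> U)"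

definition lie_ideal :: "'v set \<Rightarrow> bool" where
  "lie_ideal I \<longleftrightarrow> subspace I \<and> I \<subseteq> L \<and> (\<forall>x\<in>L. \<forall>y\<in>I. bracket x y \<in> I)"

definition maximal_subalgebra :: "'v set \<Rightarrow> bool" where
  "maximal_subalgebra M \<longleftrightarrow> subalgebra M \<and> M \<noteq> L \<and>
     (\<forall>U. subalgebra U \<and> M \<subseteq> U \<longrightarrow> U = M \<or> U = L)"

primrec derived_series :: "nat \<Rightarrow> 'v set" where
  "derived_series 0 = L"
| "derived_series (Suc n) =
     span {bracket x y | x y. x \<in> derived_series n \<and> y \<in> derived_series n}"

definition solvable :: bool where
  "solvable \<longleftrightarrow> (\<exists>n. derived_series n = {0})"

text \<open>A full flag of ideals of \<open>L\<close>; since it starts at \<open>{0}\<close>, this forces \<open>dim L\<close> to be finite.\<close>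

definition supersolvable :: bool where
  "supersolvable \<longleftrightarrow> (\<exists>n I. I 0 = {0} \<and> I n = L \<and>
     (\<forall>i\<le>n. lie_ideal (I i) \<and> dim (I i) = i) \<and> (\<forall>i<n. I i \<subseteq> I (Suc i)))"

definition engel_subalgebra :: "'v \<Rightarrow> 'v set" where
  "engel_subalgebra x = {y \<in> L. \<exists>n. (bracket x ^^ n) y = 0}"

definition core :: "'v set \<Rightarrow> 'v set" where
  "core U = (GREATEST I. lie_ideal I \<and> I \<subseteq> U)"

definition G_set :: "'v set set" where
  "G_set = {M. maximal_subalgebra M \<and> (\<exists>x\<in>L. engel_subalgebra x \<subseteq> M)}"

text \<open>For finite-dimensional \<open>L\<close>, the codimension of \<open>M\<close> in \<open>L\<close> is \<open>dim L - dim M\<close>.\<close>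

definition H_set :: "'v set set" where
  "H_set = {M. maximal_subalgebra M \<and> dim L - dim M > 1}"

definition D_set :: "'v set set" where
  "D_set = G_set \<inter> H_set"

definition H_inter :: "'v set" where
  "H_inter = (if H_set \<noteq> {} then \<Inter>H_set else L)"

definition eta :: "'v set" where
  "eta = core H_inter"

definition D_inter :: "'v set" where
  "D_inter = (if D_set \<noteq> {} then \<Inter>D_set else L)"

definition delta :: "'v set" where
  "delta = core D_inter"

text \<open>The lemmas up to \<open>core_greatest\<close> show that \<open>GREATEST\<close> in \<open>core\<close> is well-defined on subspaces.\<close>

lemma bracket_zero_right: "x \<in> L \<Longrightarrow> bracket x 0 = 0"
  using bracket_scale_right[of x x 0] by simp

lemma lie_ideal_span_Union:
  assumes "\<And>I. I \<in> S \<Longrightarrow> lie_ideal I"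
  shows "lie_ideal (span (\<Union>S))"
proof -
  have sub: "span (\<Union>S) \<subseteq> L"
    using assms by (intro span_minimal subspace_carrier) (auto simp: lie_ideal_def)
  have "bracket x y \<in> span (\<Union>S)" if x: "x \<in> L" and y: "y \<in> span (\<Union>S)" for x y
  proof -
    have "y \<in> L \<and> bracket x y \<in> span (\<Union>S)"
      using y
    proof (induction rule: span_induct_alt)
      case base
      show ?case
        using x by (simp add: bracket_zero_right span_zero subspace_0 subspace_carrier)
    next
      case (step c u v)
      then obtain I where I: "I \<in> S" "u \<in> I" by blast
      then have u: "u \<in> L" "bracket x u \<in> span (\<Union>S)"
        using assms[OF I(1)] x by (auto simp: lie_ideal_def intro!: span_base)
      have cu: "c *s u \<in> L"
        using u(1) subspace_carrier by (rule subspace_scale[rotated])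
      have "bracket x (c *s u + v) = c *s bracket x u + bracket x v"
        using x u cu step by (simp add: bracket_add_right bracket_scale_right)
      then show ?case
        using u cu step subspace_carrier by (simp add: span_add span_scale subspace_add)
    qed
    then show ?thesis ..
  qed
  with sub show ?thesis
    by (simp add: lie_ideal_def)
qed

lemma core_greatest:
  assumes "subspace U"
  shows "lie_ideal (core U)" "core U \<subseteq> U" "\<And>J. \<lbrakk>lie_ideal J; J \<subseteq> U\<rbrakk> \<Longrightarrow> J \<subseteq> core U"
proof -
  define C where "C = span (\<Union>{I. lie_ideal I \<and> I \<subseteq> U})"
  have C: "lie_ideal C"
    unfolding C_def by (rule lie_ideal_span_Union) simp
  have "C \<subseteq> U"
    unfolding C_def by (rule span_minimal[OF _ assms]) blast
  note C = C this
  have max: "J \<subseteq> C" if "lie_ideal J" "J \<subseteq> U" for J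
    unfolding C_def using that by (blast intro: span_base)
  have "core U = C"
    unfolding core_def by (rule Greatest_equality) (use C max in auto)
  with C max show "lie_ideal (core U)" "core U \<subseteq> U"
    "\<And>J. \<lbrakk>lie_ideal J; J \<subseteq> U\<rbrakk> \<Longrightarrow> J \<subseteq> core U" by auto
qed

lemma subspace_H_inter: "subspace H_inter"
  by (auto simp: H_inter_def H_set_def maximal_subalgebra_def subalgebra_def
      intro!: subspace_Inter subspace_carrier)

lemma subspace_D_inter: "subspace D_inter"
  by (auto simp: D_inter_def D_set_def H_set_def maximal_subalgebra_def subalgebra_def
      intro!: subspace_Inter subspace_carrier)

lemma lie_ideal_eta: "lie_ideal eta" and lie_ideal_delta: "lie_ideal delta"
  unfolding eta_def delta_def
  by (intro core_greatest subspace_H_inter subspace_D_inter)+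

lemma lie_algebra_lie_ideal:
  assumes "lie_ideal I"
  shows "lie_algebra scale I bracket"
proof -
  have I: "subspace I" "\<And>x. x \<in> I \<Longrightarrow> x \<in> L" "\<And>x y. \<lbrakk>x \<in> L; y \<in> I\<rbrakk> \<Longrightarrow> bracket x y \<in> I"
    using assms by (auto simp: lie_ideal_def)
  show ?thesis
    by unfold_locales
      (auto simp: I bracket_add_left bracket_add_right bracket_scale_left bracket_scale_right
        bracket_self jacobi)
qed

end

locale finite_dimensional_lie_algebra = lie_algebra +
  assumes finite_dimensional: "\<exists>B. finite B \<and> span B = L"

end

theory Submission
  imports Defs
begin

text \<open>
  Let \<open>D\<close> be an ideal of the solvable algebra \<open>L\<close> that lies in every maximal subalgebra which has
  codimension greater than 1 and contains an Engel subalgebra; both \<open>\<delta>(L)\<close> and \<open>\<eta>(L)\<close> are such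
  ideals. Refine \<open>{0} \<subseteq> D\<close> to a series of ideals of \<open>L\<close> whose factors \<open>B / A\<close> are chief, i.e.
  irreducible under \<open>L\<close>. It suffices to refine each of these further to steps of dimension 1
  stable under \<open>D\<close>, and this is done from the top of \<open>D\<close> downwards
  (\<open>flagged_ideal\<close>, \<open>flagged_chief_step\<close>).

  The main tool is a subalgebra attached to \<open>x \<in> L\<close> and an additively closed set \<open>C\<close> of scalars with
  \<open>0 \<in> C\<close>: the preimage \<open>split_part x C A\<close> in \<open>L\<close> of the sum of the generalised eigenspaces of
  \<open>ad x\<close> on \<open>L / A\<close> for eigenvalues in \<open>C\<close>. It contains the Engel subalgebra of \<open>x\<close>. Suppose that
  \<open>L / B\<close> is the sum of its generalised eigenspaces for \<open>C\<close>, and that \<open>x\<close> belongs to an ideal which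
  acts on \<open>B / A\<close> by commuting operators. By the latter, \<open>split_part x C A \<inter> B\<close> is an ideal of \<open>L\<close>,
  hence \<open>A\<close> or \<open>B\<close>. If it is \<open>A\<close>, then no eigenvalue on \<open>B / A\<close> lies in \<open>C\<close>, so \<open>split_part x C A\<close>
  complements \<open>B\<close> modulo \<open>A\<close>. It is then a maximal subalgebra of codimension \<open>dim (B / A)\<close> that does
  not contain \<open>B\<close>. For \<open>B \<subseteq> D\<close> and \<open>dim (B / A) > 1\<close> this contradicts the assumption on \<open>D\<close>, so all
  of \<open>B / A\<close> is a sum of generalised eigenspaces for \<open>C\<close> (\<open>chief_factor_subset_split_part\<close>).

  Let \<open>B / A\<close> be such a factor, with \<open>D / B\<close> already refined to steps of dimension 1. Elements of
  \<open>[D, D]\<close> act as 0 on steps of dimension 1, hence nilpotently on \<open>L / B\<close>, and the tool with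
  \<open>C = {0}\<close> shows that \<open>[D, D]\<close> acts trivially on \<open>B / A\<close>
  (\<open>derived_ideal_kills_chief_factor\<close>). So \<open>D\<close> acts on \<open>B / A\<close> by commuting operators. Elements
  of \<open>D\<close> have all their eigenvalues on \<open>L / B\<close> in the field, and the tool with \<open>C = F\<close> gives the same
  on \<open>B / A\<close>. Commuting operators with all eigenvalues in the field are simultaneously
  triangularisable (\<open>commuting_eigenline\<close>), which yields the required refinement.

  Quotients are avoided by working in \<open>L\<close> modulo \<open>A\<close> or \<open>B\<close> throughout.
\<close>

section \<open>Ideals and chief factors\<close>

context lie_algebra
begin

lemma carrier_closed:
  "0 \<in> L"
  "\<lbrakk>x \<in> L; y \<in> L\<rbrakk> \<Longrightarrow> x + y \<in> L"
  "\<lbrakk>x \<in> L; y \<in> L\<rbrakk> \<Longrightarrow> x - y \<in> L"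
  "x \<in> L \<Longrightarrow> - x \<in> L"
  "x \<in> L \<Longrightarrow> c *s x \<in> L"
  using subspace_carrier
  by (auto intro: subspace_0 subspace_add subspace_diff subspace_neg subspace_scale)

lemma lie_idealD:
  assumes "lie_ideal I"
  shows "subspace I" "x \<in> I \<Longrightarrow> x \<in> L" "\<lbrakk>x \<in> L; y \<in> I\<rbrakk> \<Longrightarrow> bracket x y \<in> I"
  using assms by (auto simp: lie_ideal_def)

lemma bracket_minus_right: "\<lbrakk>x \<in> L; y \<in> L\<rbrakk> \<Longrightarrow> bracket x (- y) = - bracket x y"
  using bracket_scale_right[of x y "- 1"] by simp

lemma bracket_minus_left: "\<lbrakk>x \<in> L; y \<in> L\<rbrakk> \<Longrightarrow> bracket (- x) y = - bracket x y"
  using bracket_scale_left[of x y "- 1"] by simp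

lemma bracket_diff_right:
  "\<lbrakk>x \<in> L; y \<in> L; z \<in> L\<rbrakk> \<Longrightarrow> bracket x (y - z) = bracket x y - bracket x z"
  using bracket_add_right[of x y "- z"] by (simp add: bracket_minus_right carrier_closed)

lemma bracket_diff_left:
  "\<lbrakk>x \<in> L; y \<in> L; z \<in> L\<rbrakk> \<Longrightarrow> bracket (x - y) z = bracket x z - bracket y z"
  using bracket_add_left[of x "- y" z] by (simp add: bracket_minus_left carrier_closed)

lemma bracket_zero_left: "x \<in> L \<Longrightarrow> bracket 0 x = 0"
  using bracket_scale_left[of x x 0] by simp

lemma bracket_anticomm:
  assumes "x \<in> L" "y \<in> L"
  shows "bracket x y = - bracket y x"
proof -
  have "bracket (x + y) (x + y) = bracket x y + bracket y x"
    using assms bracket_add_left[of x y "x + y"] bracket_add_right[of x x y]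
      bracket_add_right[of y x y] bracket_self[of x] bracket_self[of y]
    by (simp add: carrier_closed del: bracket_self)
  then have "bracket x y + bracket y x = 0"
    using bracket_self[of "x + y"] assms by (simp add: carrier_closed)
  then show ?thesis
    by (simp add: eq_neg_iff_add_eq_0)
qed

lemma lie_ideal_bracket_left:
  assumes "lie_ideal I" "x \<in> I" "y \<in> L"
  shows "bracket x y \<in> I"
  using assms bracket_anticomm[of x y] lie_idealD[OF assms(1)]
  by (auto intro: subspace_neg)

lemma bracket_derivation:
  assumes "x \<in> L" "y \<in> L" "z \<in> L"
  shows "bracket x (bracket y z) = bracket (bracket x y) z + bracket y (bracket x z)"
proof -
  have "bracket x (bracket y z) = - bracket y (bracket z x) - bracket z (bracket x y)"
    using jacobi[OF assms] by (simp add: algebra_simps eq_neg_iff_add_eq_0)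
  moreover have "bracket y (bracket z x) = - bracket y (bracket x z)"
    using assms bracket_anticomm[of z x] by (simp add: bracket_minus_right bracket_closed)
  moreover have "bracket z (bracket x y) = - bracket (bracket x y) z"
    using assms by (intro bracket_anticomm) (auto simp: bracket_closed)
  ultimately show ?thesis by simp
qed

lemma lie_ideal_carrier: "lie_ideal L"
  by (simp add: lie_ideal_def subspace_carrier bracket_closed)

lemma lie_ideal_zero: "lie_ideal {0}"
  by (auto simp: lie_ideal_def carrier_closed bracket_zero_right)

lemma lie_ideal_Int: "\<lbrakk>lie_ideal I; lie_ideal J\<rbrakk> \<Longrightarrow> lie_ideal (I \<inter> J)"
  by (auto simp: lie_ideal_def subspace_inter)

lemma lie_ideal_sum:
  assumes I: "lie_ideal I" and J: "lie_ideal J"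
  shows "lie_ideal {x + y | x y. x \<in> I \<and> y \<in> J}"
  unfolding lie_ideal_def
proof (intro conjI ballI)
  show "subspace {x + y |x y. x \<in> I \<and> y \<in> J}"
    by (intro subspace_sums lie_idealD(1) I J)
  show "{x + y |x y. x \<in> I \<and> y \<in> J} \<subseteq> L"
    using lie_idealD(2)[OF I] lie_idealD(2)[OF J] by (auto simp: carrier_closed)
  fix z w assume z: "z \<in> L" and "w \<in> {x + y |x y. x \<in> I \<and> y \<in> J}"
  then obtain x y where w: "w = x + y" "x \<in> I" "y \<in> J" by auto
  then have "bracket z w = bracket z x + bracket z y"
    using z lie_idealD(2)[OF I] lie_idealD(2)[OF J] by (simp add: bracket_add_right)
  then show "bracket z w \<in> {x + y |x y. x \<in> I \<and> y \<in> J}"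
    using w z lie_idealD(3)[OF I] lie_idealD(3)[OF J] by blast
qed

definition derived_ideal :: "'v set \<Rightarrow> 'v set" where
  "derived_ideal I = span {bracket x y | x y. x \<in> I \<and> y \<in> I}"

lemma derived_ideal_subset:
  assumes "lie_ideal I"
  shows "derived_ideal I \<subseteq> I"
  unfolding derived_ideal_def
  by (rule span_minimal) (auto intro: lie_idealD[OF assms])

lemma bracket_in_derived_ideal: "\<lbrakk>x \<in> I; y \<in> I\<rbrakk> \<Longrightarrow> bracket x y \<in> derived_ideal I"
  unfolding derived_ideal_def by (rule span_base) blast

lemma lie_ideal_derived_ideal:
  assumes I: "lie_ideal I"
  shows "lie_ideal (derived_ideal I)"
  unfolding lie_ideal_def
proof (intro conjI ballI)
  show sub: "subspace (derived_ideal I)"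
    by (simp add: derived_ideal_def)
  show "derived_ideal I \<subseteq> L"
    using derived_ideal_subset[OF I] lie_idealD(2)[OF I] by blast
  fix z w assume z: "z \<in> L" and "w \<in> derived_ideal I"
  then have "w \<in> span {bracket x y | x y. x \<in> I \<and> y \<in> I}"
    by (simp add: derived_ideal_def)
  then have "w \<in> L \<and> bracket z w \<in> derived_ideal I"
  proof (induction rule: span_induct_alt)
    case base
    show ?case
      using z by (simp add: carrier_closed bracket_zero_right subspace_0[OF sub])
  next
    case (step c u v)
    then obtain x y where u: "u = bracket x y" "x \<in> I" "y \<in> I" by blast
    have L: "x \<in> L" "y \<in> L" using u lie_idealD(2)[OF I] by auto
    have "bracket z u = bracket (bracket z x) y + bracket x (bracket z y)"
      unfolding u(1) by (rule bracket_derivation[OF z L])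
    moreover have "bracket z x \<in> I" "bracket z y \<in> I"
      using u z by (auto intro: lie_idealD[OF I])
    ultimately have "bracket z u \<in> derived_ideal I"
      using u by (simp add: sub subspace_add bracket_in_derived_ideal)
    moreover have "u \<in> L" using u L by (simp add: bracket_closed)
    ultimately show ?case
      using step.IH z
      by (simp add: bracket_add_right bracket_scale_right carrier_closed
          subspace_add[OF sub] subspace_scale[OF sub])
  qed
  then show "bracket z w \<in> derived_ideal I" ..
qed

lemma derived_series_Suc_eq: "derived_series (Suc n) = derived_ideal (derived_series n)"
  by (simp add: derived_ideal_def)

lemma lie_ideal_derived_series: "lie_ideal (derived_series n)"
proof (induction n)
  case 0
  show ?case by (simp add: lie_ideal_carrier)
next
  case (Suc n)
  then show ?case
    unfolding derived_series_Suc_eq by (rule lie_ideal_derived_ideal)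
qed

text \<open>
  For a property such as acting nontrivially on a chief factor, this yields an ideal of \<open>L\<close> that acts
  nontrivially while its commutators act trivially.
\<close>
lemma solvable_jump:
  assumes "solvable" "P L" "\<not> P {0}"
  obtains n where "P (derived_series n)" "\<not> P (derived_series (Suc n))"
proof -
  obtain m where "derived_series m = {0}"
    using assms(1) by (auto simp: solvable_def)
  then obtain n where "P (derived_series n)" "\<not> P (derived_series (Suc n))"
    using ex_least_nat_less[of "\<lambda>n. \<not> P (derived_series n)" m] assms(2,3)
    by (auto simp del: derived_series.simps(2))
  then show thesis by (rule that)
qed

definition chief_factor :: "'v set \<Rightarrow> 'v set \<Rightarrow> bool" where
  "chief_factor A B \<longleftrightarrow> lie_ideal A \<and> lie_ideal B \<and> A \<subset> B \<and>
     (\<forall>I. lie_ideal I \<and> A \<subseteq> I \<and> I \<subseteq> B \<longrightarrow> I = A \<or> I = B)"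

lemma chief_factorD:
  assumes "chief_factor A B"
  shows "lie_ideal A" "lie_ideal B" "A \<subseteq> B" "A \<noteq> B"
    "\<lbrakk>lie_ideal I; A \<subseteq> I; I \<subseteq> B\<rbrakk> \<Longrightarrow> I = A \<or> I = B"
  using assms by (auto simp: chief_factor_def)

text \<open>
  For the last derived term whose intersection with \<open>B\<close> is not inside \<open>A\<close>, that intersection
  generates \<open>B\<close> modulo \<open>A\<close>, and brackets of its elements fall into the next term, hence into \<open>A\<close>.
\<close>
lemma chief_factor_abelian:
  assumes "solvable" and AB: "chief_factor A B" and b: "b \<in> B" "b' \<in> B"
  shows "bracket b b' \<in> A"
proof -
  note A = chief_factorD(1)[OF AB] and B = chief_factorD(2)[OF AB]
  note inL = lie_idealD(2)[OF A] lie_idealD(2)[OF B]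
  have "L \<inter> B = B" using inL by blast
  then have top: "\<not> L \<inter> B \<subseteq> A" using chief_factorD(3,4)[OF AB] by simp
  have bot: "\<not> \<not> {0} \<inter> B \<subseteq> A"
    using subspace_0[OF lie_idealD(1)[OF A]] by auto
  obtain n where n: "\<not> derived_series n \<inter> B \<subseteq> A" "derived_series (Suc n) \<inter> B \<subseteq> A"
    using solvable_jump[of "\<lambda>X. \<not> X \<inter> B \<subseteq> A", OF assms(1) top bot] by metis
  define I where "I = {x + y | x y. x \<in> derived_series n \<inter> B \<and> y \<in> A}"
  have "lie_ideal I"
    unfolding I_def by (intro lie_ideal_sum lie_ideal_Int lie_ideal_derived_series A B)
  moreover have "A \<subseteq> I"
  proof
    fix a assume "a \<in> A"
    then show "a \<in> I"
      unfolding I_def using subspace_0[OF lie_idealD(1)[OF lie_ideal_derived_series[of n]]]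
        subspace_0[OF lie_idealD(1)[OF B]] by force
  qed
  moreover have "I \<subseteq> B"
    using chief_factorD(3)[OF AB] subspace_add[OF lie_idealD(1)[OF B]] by (auto simp: I_def)
  moreover have "I \<noteq> A"
  proof
    assume "I = A"
    moreover have "derived_series n \<inter> B \<subseteq> I"
      unfolding I_def using subspace_0[OF lie_idealD(1)[OF A]] by force
    ultimately show False using n by blast
  qed
  ultimately have "I = B" using chief_factorD(5)[OF AB] by blast
  with b obtain x y x' y' where xy: "b = x + y" "x \<in> derived_series n" "x \<in> B" "y \<in> A"
      "b' = x' + y'" "x' \<in> derived_series n" "x' \<in> B" "y' \<in> A"
    unfolding I_def by blast
  have "bracket x x' \<in> derived_series (Suc n)"
    using xy unfolding derived_series_Suc_eq by (intro bracket_in_derived_ideal)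
  moreover have "bracket x x' \<in> B" using xy inL by (intro lie_idealD(3)[OF B]) auto
  ultimately have "bracket x x' \<in> A" using n by blast
  moreover have "bracket x y' \<in> A" "bracket y b' \<in> A"
    using xy b inL by (auto intro: lie_idealD(3)[OF A] lie_ideal_bracket_left[OF A])
  moreover have "bracket b b' = bracket x x' + bracket x y' + bracket y b'"
    using xy b inL by (simp add: bracket_add_left bracket_add_right carrier_closed)
  ultimately show ?thesis
    by (simp add: subspace_add[OF lie_idealD(1)[OF A]])
qed

section \<open>Generalised eigenspaces of inner derivations\<close>
definition shifted_ad :: "'v \<Rightarrow> 'f \<Rightarrow> 'v \<Rightarrow> 'v" where
  "shifted_ad x c y = bracket x y - c *s y"

lemma shifted_ad_zero: "shifted_ad x 0 = bracket x"
  by (simp add: shifted_ad_def fun_eq_iff)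

lemma shifted_ad_closed:
  assumes "subspace W" "\<And>w. w \<in> W \<Longrightarrow> bracket x w \<in> W" "w \<in> W"
  shows "shifted_ad x c w \<in> W"
  using assms by (auto simp: shifted_ad_def intro: subspace_diff subspace_scale)

lemma shifted_ad_carrier: "\<lbrakk>x \<in> L; y \<in> L\<rbrakk> \<Longrightarrow> shifted_ad x c y \<in> L"
  by (simp add: shifted_ad_def bracket_closed carrier_closed)

lemma shifted_ad_ideal: "\<lbrakk>lie_ideal I; x \<in> L; y \<in> I\<rbrakk> \<Longrightarrow> shifted_ad x c y \<in> I"
  by (rule shifted_ad_closed) (auto intro: lie_idealD)

lemma shifted_ad_linear:
  assumes "x \<in> L" "y \<in> L" 
  shows "z \<in> L \<Longrightarrow> shifted_ad x c (y + z) = shifted_ad x c y + shifted_ad x c z"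
    "z \<in> L \<Longrightarrow> shifted_ad x c (y - z) = shifted_ad x c y - shifted_ad x c z"
    "shifted_ad x c (d *s y) = d *s shifted_ad x c y"
  using assms
  by (auto simp: shifted_ad_def bracket_add_right bracket_diff_right bracket_scale_right
      carrier_closed scale_right_distrib scale_right_diff_distrib mult.commute)

lemma shifted_ad_commute:
  assumes "x \<in> L" "y \<in> L"
  shows "shifted_ad x c (shifted_ad x d y) = shifted_ad x d (shifted_ad x c y)"
  using assms
  by (simp add: shifted_ad_def bracket_diff_right bracket_scale_right bracket_closed
      carrier_closed scale_right_diff_distrib mult.commute)

text \<open>
  Since \<open>ad x\<close> is a derivation, brackets of generalised eigenvectors for \<open>c\<close> and \<open>d\<close> are generalised
  eigenvectors for \<open>c + d\<close>.
\<close>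
lemma shifted_ad_bracket:
  assumes "x \<in> L" "y \<in> L" "z \<in> L"
  shows "shifted_ad x (c + d) (bracket y z) =
    bracket (shifted_ad x c y) z + bracket y (shifted_ad x d z)"
  using assms bracket_derivation[OF assms]
  by (simp add: shifted_ad_def bracket_diff_right bracket_diff_left
      bracket_scale_left bracket_scale_right bracket_closed carrier_closed scale_left_distrib)

lemma shifted_ad_bracket_right:
  assumes "x \<in> L" "y \<in> L" "z \<in> L"
  shows "shifted_ad x c (bracket y z) = bracket y (shifted_ad x c z) + bracket (bracket x y) z"
  using shifted_ad_bracket[OF assms, of 0 c] by (simp add: shifted_ad_zero)

text \<open>
  The elements that some product of operators \<open>ad x - c\<close> with \<open>c \<in> C\<close> maps into \<open>W\<close>. For an ideal
  \<open>W\<close> this is the preimage of the sum of the generalised eigenspaces of \<open>ad x\<close> on \<open>L / W\<close> for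
  eigenvalues in \<open>C\<close>. The inductive form strips off one factor at a time, so that neither products
  nor multiplicities need a name.
\<close>
inductive_set split_part :: "'v \<Rightarrow> 'f set \<Rightarrow> 'v set \<Rightarrow> 'v set"
  for x :: 'v and C :: "'f set" and W :: "'v set" where
  base: "y \<in> W \<Longrightarrow> y \<in> split_part x C W"
| step: "\<lbrakk>y \<in> L; c \<in> C; shifted_ad x c y \<in> split_part x C W\<rbrakk> \<Longrightarrow> y \<in> split_part x C W"

lemma split_part_carrier:
  assumes "W \<subseteq> L" "y \<in> split_part x C W"
  shows "y \<in> L"
  using assms(2) by cases (use assms(1) in auto)

lemma subset_split_part:
  assumes "V \<subseteq> L" "c \<in> C" "\<And>v. v \<in> V \<Longrightarrow> shifted_ad x c v \<in> W"
  shows "V \<subseteq> split_part x C W"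
  using assms by (blast intro: split_part.step[of _ c] split_part.base)

lemma split_part_trans:
  assumes "y \<in> split_part x C V" "V \<subseteq> split_part x C W"
  shows "y \<in> split_part x C W"
  using assms(1)
proof induction
  case (base y)
  then show ?case using assms(2) by blast
next
  case (step y c)
  show ?case by (intro split_part.step[OF step.hyps(1,2)] step.IH)
qed

lemma split_part_shifted_ad:
  assumes W: "lie_ideal W" and x: "x \<in> L" and y: "y \<in> split_part x C W"
  shows "shifted_ad x d y \<in> split_part x C W"
  using y
proof induction
  case (base y)
  then show ?case by (intro split_part.base shifted_ad_ideal W x)
next
  case (step y c)
  show ?case
  proof (rule split_part.step)
    show "shifted_ad x c (shifted_ad x d y) \<in> split_part x C W"
      using step.IH shifted_ad_commute[OF x step.hyps(1)] by simp
  qed (use step x shifted_ad_carrier in auto)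
qed

lemma split_part_add:
  assumes W: "lie_ideal W" and x: "x \<in> L" and y: "y \<in> split_part x C W"
    and z: "z \<in> split_part x C W"
  shows "y + z \<in> split_part x C W"
  using y z
proof (induction arbitrary: z)
  case (base y)
  show ?case
    using base(2,1)
  proof (induction arbitrary: y)
    case (base z)
    then show ?case by (intro split_part.base subspace_add lie_idealD W)
  next
    case (step z c)
    then have "shifted_ad x c y + shifted_ad x c z \<in> split_part x C W"
      using x W by (auto intro: shifted_ad_ideal)
    then show ?case
      using step.hyps x lie_idealD(2)[OF W step.prems]
      by (intro split_part.step[of "y + z" c]) (simp_all add: shifted_ad_linear carrier_closed)
  qed
next
  case (step y c)
  have z: "z \<in> L" using step.prems lie_idealD(2)[OF W] split_part_carrier by blast
  have "shifted_ad x c y + shifted_ad x c z \<in> split_part x C W"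
    using step.IH[OF split_part_shifted_ad[OF W x step.prems]] .
  then show ?case
    using step.hyps x z
    by (intro split_part.step[of "y + z" c]) (simp_all add: shifted_ad_linear carrier_closed)
qed

lemma subspace_split_part:
  assumes W: "lie_ideal W" and x: "x \<in> L"
  shows "subspace (split_part x C W)"
  unfolding subspace_def
proof (intro conjI ballI allI)
  show "0 \<in> split_part x C W"
    by (intro split_part.base subspace_0 lie_idealD W)
  show "y + z \<in> split_part x C W" if "y \<in> split_part x C W" "z \<in> split_part x C W" for y z
    using split_part_add[OF W x that] .
  show "d *s y \<in> split_part x C W" if "y \<in> split_part x C W" for d y
    using that
  proof induction
    case (base y)
    then show ?case by (intro split_part.base subspace_scale lie_idealD W)
  next
    case (step y c)
    then show ?case
      using x
      by (intro split_part.step[of "d *s y" c]) (simp_all add: shifted_ad_linear carrier_closed)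
  qed
qed

lemma split_part_bracket:
  assumes W: "lie_ideal W" and x: "x \<in> L" and C: "\<And>c d. \<lbrakk>c \<in> C; d \<in> C\<rbrakk> \<Longrightarrow> c + d \<in> C"
    and y: "y \<in> split_part x C W" and z: "z \<in> split_part x C W"
  shows "bracket y z \<in> split_part x C W"
proof -
  have inL: "v \<in> L" if "v \<in> split_part x C W" for v
    using that lie_idealD(2)[OF W] split_part_carrier by blast
  show ?thesis
    using y z
  proof (induction arbitrary: z)
    case (base y)
    then show ?case using inL by (intro split_part.base lie_ideal_bracket_left W)
  next
    case (step y c)
    show ?case
      using step.prems
    proof induction
      case (base z)
      then show ?case using step by (intro split_part.base lie_idealD(3) W)
    next
      case (step z d)
      have "shifted_ad x (c + d) (bracket y z) \<in> split_part x C W"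
        unfolding shifted_ad_bracket[OF x \<open>y \<in> L\<close> \<open>z \<in> L\<close>]
        by (rule split_part_add[OF W x \<open>\<And>z. z \<in> split_part x C W \<Longrightarrow>
              bracket (shifted_ad x c y) z \<in> split_part x C W\<close> step.IH])
          (rule split_part.step[OF step.hyps])
      then show ?case
        using \<open>c \<in> C\<close> step.hyps \<open>y \<in> L\<close> C
        by (intro split_part.step[of "bracket y z" "c + d"]) (simp_all add: bracket_closed)
    qed
  qed
qed

lemma subalgebra_split_part:
  assumes "lie_ideal W" "x \<in> L" "\<And>c d. \<lbrakk>c \<in> C; d \<in> C\<rbrakk> \<Longrightarrow> c + d \<in> C"
  shows "subalgebra (split_part x C W)"
  unfolding subalgebra_def
  using subspace_split_part[OF assms(1,2)] split_part_bracket[OF assms]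
    split_part_carrier lie_idealD(2)[OF assms(1)] by blast

lemma engel_subset_split_part:
  assumes W: "lie_ideal W" and x: "x \<in> L" and C: "0 \<in> C"
  shows "engel_subalgebra x \<subseteq> split_part x C W"
proof
  fix y assume "y \<in> engel_subalgebra x"
  then obtain n where "y \<in> L" "(bracket x ^^ n) y = 0"
    by (auto simp: engel_subalgebra_def)
  then show "y \<in> split_part x C W"
  proof (induction n arbitrary: y)
    case 0
    then show ?case
      by (simp add: split_part.base subspace_0 lie_idealD[OF W])
  next
    case (Suc n)
    then have "bracket x y \<in> split_part x C W"
      using x by (simp add: funpow_swap1 bracket_closed)
    then show ?case
      using Suc.prems C by (intro split_part.step[of y 0]) (simp_all add: shifted_ad_zero)
  qed
qed

text \<open>
  If \<open>u \<in> J\<close> then \<open>u\<close> commutes with \<open>x\<close> on \<open>B / A\<close> and so preserves the generalised eigenspaces of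
  \<open>ad x\<close> there. For arbitrary \<open>y \<in> L\<close> the defect \<open>[x, y]\<close> lies in \<open>J\<close>, so the first case controls the
  error term of the second.
\<close>
lemma split_part_Int_ideal:
  assumes A: "lie_ideal A" and B: "lie_ideal B" and J: "lie_ideal J" and x: "x \<in> J"
    and comm: "\<And>u v b. \<lbrakk>u \<in> J; v \<in> J; b \<in> B\<rbrakk> \<Longrightarrow> bracket (bracket u v) b \<in> A"
  shows "lie_ideal (split_part x C A \<inter> B)"
proof -
  have xL: "x \<in> L" using lie_idealD(2)[OF J x] .
  note sub = subspace_split_part[OF A xL, of C]
  \<comment> \<open>Elements of \<open>J\<close> first: here the error term lies in \<open>A\<close>.\<close>
  have inJ: "bracket u b \<in> split_part x C A"
    if "b \<in> split_part x C A" "b \<in> B" "u \<in> J" for u b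
    using that
  proof induction
    case (base b)
    then show ?case using lie_idealD(2)[OF J] by (intro split_part.base lie_idealD(3)[OF A])
  next
    case (step b c)
    have uL: "u \<in> L" using lie_idealD(2)[OF J step.prems(2)] .
    have "bracket u (shifted_ad x c b) \<in> split_part x C A"
      using step xL by (auto intro: shifted_ad_ideal[OF B])
    moreover have "bracket (bracket x u) b \<in> split_part x C A"
      using step x by (intro split_part.base comm)
    ultimately show ?case
      using step uL xL
      by (intro split_part.step[of "bracket u b" c])
        (simp_all add: shifted_ad_bracket_right bracket_closed split_part_add[OF A])
  qed
  have inL: "bracket y b \<in> split_part x C A"
    if "b \<in> split_part x C A" "b \<in> B" "y \<in> L" for y b
    using that
  proof induction
    case (base b)
    then show ?case by (intro split_part.base lie_idealD(3)[OF A])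
  next
    case (step b c)
    have "bracket y (shifted_ad x c b) \<in> split_part x C A"
      using step xL by (auto intro: shifted_ad_ideal[OF B])
    moreover have "bracket (bracket x y) b \<in> split_part x C A"
      using step by (intro inJ split_part.step[of b c] lie_ideal_bracket_left[OF J x])
    ultimately show ?case
      using step xL
      by (intro split_part.step[of "bracket y b" c])
        (simp_all add: shifted_ad_bracket_right bracket_closed split_part_add[OF A])
  qed
  then show ?thesis
    using sub lie_idealD[OF B] by (auto simp: lie_ideal_def subspace_inter)
qed

section \<open>Flags of stable subspaces\<close>

text \<open>
  \<open>flagged D W\<close>: a chain of \<open>D\<close>-stable subspaces with steps of dimension 1 leads from \<open>W\<close> up to \<open>D\<close>.
  It grows downwards because the argument knows \<open>D / B\<close> when it treats the chief factor \<open>B / A\<close>.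
\<close>
inductive flagged :: "'v set \<Rightarrow> 'v set \<Rightarrow> bool" for D :: "'v set" where
  top: "flagged D D"
| step: "\<lbrakk>flagged D V; subspace W; W \<subseteq> V; \<And>x w. \<lbrakk>x \<in> D; w \<in> W\<rbrakk> \<Longrightarrow> bracket x w \<in> W;
    dim V = Suc (dim W)\<rbrakk> \<Longrightarrow> flagged D W"

lemma flagged_stable:
  assumes D: "lie_ideal D" and "flagged D W"
  shows "subspace W \<and> W \<subseteq> D \<and> (\<forall>x\<in>D. \<forall>w\<in>W. bracket x w \<in> W)"
  using assms(2) by induction (use D lie_idealD[OF D] in auto)

end

context finite_dimensional_lie_algebra
begin

section \<open>Dimension counts inside the carrier\<close>

lemma subspace_basis:
  assumes "subspace W" "W \<subseteq> L"
  obtains X where "finite X" "independent X" "span X = W" "card X = dim W"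
proof -
  obtain X where X: "X \<subseteq> W" "independent X" "W \<subseteq> span X" "card X = dim W"
    using basis_exists by blast
  obtain B where "finite B" "span B = L" using finite_dimensional by blast
  then have "finite X" using independent_span_bound[of B X] X assms by auto
  moreover have "span X = W" using X assms(1) by (auto dest: span_minimal)
  ultimately show thesis using that X by blast
qed

lemma dim_mono:
  assumes "subspace U" "subspace W" "W \<subseteq> L" "U \<subseteq> W"
  shows "dim U \<le> dim W"
proof -
  obtain X where X: "finite X" "independent X" "span X = U" "card X = dim U"
    using subspace_basis[OF assms(1)] assms by blast
  obtain Y where Y: "finite Y" "independent Y" "span Y = W" "card Y = dim W"
    using subspace_basis[OF assms(2,3)] by blast
  show ?thesis
    using independent_span_bound[OF Y(1) X(2)] X Y assms(4) span_superset by auto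
qed

lemma dim_span_insert:
  assumes "subspace W" "W \<subseteq> L" "v \<notin> W"
  shows "dim (span (insert v W)) = Suc (dim W)"
proof -
  obtain X where X: "finite X" "independent X" "span X = W" "card X = dim W"
    using subspace_basis[OF assms(1,2)] by blast
  have "independent (insert v X)" using X assms(3) by (simp add: independent_insert)
  moreover have "v \<notin> X" using X assms(3) span_superset by blast
  moreover have "span (insert v W) = span (insert v X)"
    unfolding X(3)[symmetric] by (simp only: span_insert span_span)
  ultimately show ?thesis
    using X by (simp add: dim_eq_card[of "insert v X"])
qed

lemma subspace_insert:
  assumes "subspace U" "v \<in> U" "W \<subseteq> U"
  shows "span (insert v W) \<subseteq> U"
  by (rule span_minimal) (use assms in auto)

lemma subspace_eq_of_dim:
  assumes "subspace U" "subspace W" "W \<subseteq> L" "U \<subseteq> W" "dim W \<le> dim U"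
  shows "U = W"
proof (rule ccontr)
  assume "U \<noteq> W"
  then obtain v where v: "v \<in> W" "v \<notin> U" using assms by blast
  have "dim (span (insert v U)) \<le> dim W"
    using v assms by (intro dim_mono subspace_insert) auto
  then show False using dim_span_insert[of U v] v assms by auto
qed

text \<open>
  An injective endomorphism of the finite-dimensional space \<open>B / A\<close> is surjective: enlarging a
  subspace \<open>W\<close> between \<open>A\<close> and \<open>B\<close> by one vector enlarges its image modulo \<open>A\<close> as well, so the
  image never has smaller dimension than \<open>W\<close>.
\<close>
lemma shifted_ad_surj_modulo:
  assumes A: "lie_ideal A" and B: "lie_ideal B" and AB: "A \<subseteq> B" and x: "x \<in> L"
    and inj: "\<And>b. \<lbrakk>b \<in> B; shifted_ad x c b \<in> A\<rbrakk> \<Longrightarrow> b \<in> A"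
    and b: "b \<in> B"
  obtains b' where "b' \<in> B" "b - shifted_ad x c b' \<in> A"
proof -
  note BL = lie_idealD(2)[OF B]
  define f where "f = shifted_ad x c"
  define im where "im W = {f w + a | w a. w \<in> W \<and> a \<in> A}" for W
  have im_sub: "subspace (im W)" if "subspace W" "W \<subseteq> B" for W
  proof -
    have "subspace (f ` W)"
      unfolding subspace_def
    proof (intro conjI ballI allI)
      show "0 \<in> f ` W"
        using x subspace_0[OF that(1)]
        by (auto simp: f_def shifted_ad_def bracket_zero_right image_iff intro!: bexI[of _ 0])
      show "u + v \<in> f ` W" if uv: "u \<in> f ` W" "v \<in> f ` W" for u v
      proof -
        obtain s t where st: "u = f s" "v = f t" "s \<in> W" "t \<in> W" using uv by blast
        then have "u + v = f (s + t)"
          using x \<open>W \<subseteq> B\<close> BL by (auto simp: f_def shifted_ad_linear subset_iff)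
        then show ?thesis using st subspace_add[OF \<open>subspace W\<close>] by blast
      qed
      show "d *s u \<in> f ` W" if u: "u \<in> f ` W" for d u
      proof -
        obtain s where s: "u = f s" "s \<in> W" using u by blast
        then have "d *s u = f (d *s s)"
          using x \<open>W \<subseteq> B\<close> BL by (auto simp: f_def shifted_ad_linear subset_iff)
        then show ?thesis using s subspace_scale[OF \<open>subspace W\<close>] by blast
      qed
    qed
    from subspace_sums[OF this lie_idealD(1)[OF A]] show ?thesis
      unfolding im_def by (rule back_subst[of subspace]) blast
  qed
  have im_B: "im W \<subseteq> B" if "W \<subseteq> B" for W
    using that x AB
    by (auto simp: im_def f_def intro!: subspace_add[OF lie_idealD(1)[OF B]] shifted_ad_ideal[OF B])
  \<comment> \<open>A largest \<open>W\<close> that is not shrunk by \<open>f\<close> modulo \<open>A\<close> must be \<open>B\<close>.\<close>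
  define good where "good W \<longleftrightarrow> subspace W \<and> A \<subseteq> W \<and> W \<subseteq> B \<and> dim W \<le> dim (im W)" for W
  have "A \<subseteq> im A"
  proof
    fix a assume "a \<in> A"
    moreover have "f 0 = 0" using x by (simp add: f_def shifted_ad_def bracket_zero_right)
    ultimately show "a \<in> im A"
      unfolding im_def using subspace_0[OF lie_idealD(1)[OF A]] by force
  qed
  then have "good A"
    unfolding good_def using AB im_B[OF AB] BL
    by (auto intro!: dim_mono im_sub lie_idealD(1)[OF A])
  moreover have "dim W \<le> dim B" if "good W" for W
    using that BL by (auto simp: good_def intro!: dim_mono lie_idealD(1)[OF B])
  ultimately obtain W where W: "good W" and max: "\<And>V. good V \<Longrightarrow> dim V \<le> dim W"
    using ex_has_greatest_nat[of good A dim "Suc (dim B)"] by (auto simp: less_Suc_eq_le)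
  have "W = B"
  proof (rule ccontr)
    assume "W \<noteq> B"
    then obtain v where v: "v \<in> B" "v \<notin> W" using W by (auto simp: good_def)
    define V where "V = span (insert v W)"
    have V: "subspace V" "insert v W \<subseteq> V" "V \<subseteq> B"
      using v W subspace_insert[OF lie_idealD(1)[OF B], of v W]
      by (auto simp: V_def good_def span_base)
    have "f v \<notin> im W"
    proof
      assume "f v \<in> im W"
      then obtain w a where wa: "f v = f w + a" "w \<in> W" "a \<in> A" by (auto simp: im_def)
      have wB: "w \<in> B" using wa W by (auto simp: good_def)
      have "shifted_ad x c (v - w) = a"
        using wa v wB x BL by (simp add: f_def shifted_ad_linear)
      then have "v - w \<in> A"
        using wa v wB subspace_diff[OF lie_idealD(1)[OF B]] by (intro inj[of "v - w"]) auto
      then have "v - w + w \<in> W" using W wa by (intro subspace_add) (auto simp: good_def)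
      with v show False by simp
    qed
    moreover have "subspace (im W)" "im W \<subseteq> L"
      using W im_sub im_B[of W] BL by (auto simp: good_def)
    ultimately have "dim (span (insert (f v) (im W))) = Suc (dim (im W))"
      by (intro dim_span_insert)
    moreover have imV: "subspace (im V)" using im_sub V by blast
    have "dim (span (insert (f v) (im W))) \<le> dim (im V)"
    proof (intro dim_mono subspace_insert imV subspace_span)
      show "im V \<subseteq> L" using im_B[of V] V BL by blast
      show "f v \<in> im V"
        using V subspace_0[OF lie_idealD(1)[OF A]] unfolding im_def by force
      show "im W \<subseteq> im V" using V unfolding im_def by blast
    qed
    moreover have "dim V = Suc (dim W)"
      unfolding V_def using v W BL by (intro dim_span_insert) (auto simp: good_def)
    ultimately have "good V" "dim V > dim W" using V W by (auto simp: good_def)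
    with max show False by fastforce
  qed
  then have "im B = B"
    using W im_sub[of B] im_B[of B] BL
    by (intro subspace_eq_of_dim) (auto simp: good_def lie_idealD(1)[OF B])
  then obtain b' a where "b = f b' + a" "b' \<in> B" "a \<in> A" using b unfolding im_def by blast
  then show thesis using that by (simp add: f_def)
qed


section \<open>Complements of chief factors\<close>

text \<open>
  The hypothesis \<open>int\<close> makes \<open>ad x - c\<close> with \<open>c \<in> C\<close> injective, hence surjective, on \<open>B / A\<close>. So the
  component in \<open>B\<close> of \<open>(ad x - c) y\<close> can be removed by changing \<open>y\<close> by an element of \<open>B\<close>.
\<close>
lemma split_part_complement:
  assumes A: "lie_ideal A" and B: "lie_ideal B" and AB: "A \<subseteq> B" and x: "x \<in> L"
    and int: "split_part x C A \<inter> B = A" and y: "y \<in> split_part x C B"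
  obtains s b where "s \<in> split_part x C A" "b \<in> B" "y = s + b"
proof -
  have inL: "v \<in> L" if "v \<in> split_part x C A" for v
    using that lie_idealD(2)[OF A] split_part_carrier by blast
  have "\<exists>s b. s \<in> split_part x C A \<and> b \<in> B \<and> y = s + b"
    using y
  proof induction
    case (base y)
    have "0 \<in> split_part x C A"
      by (rule subspace_0[OF subspace_split_part[OF A x]])
    then show ?case using base by force
  next
    case (step y c)
    then obtain s b where sb: "s \<in> split_part x C A" "b \<in> B" "shifted_ad x c y = s + b"
      by blast
    have inj: "v \<in> A" if "v \<in> B" "shifted_ad x c v \<in> A" for v
      using that int step.hyps lie_idealD(2)[OF B that(1)]
      by (auto intro: split_part.step[of v c] split_part.base)
    obtain b' where b': "b' \<in> B" "b - shifted_ad x c b' \<in> A"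
      using shifted_ad_surj_modulo[OF A B AB x inj sb(2)] by blast
    have b'L: "b' \<in> L" using lie_idealD(2)[OF B b'(1)] .
    have "shifted_ad x c (y - b') = s + (b - shifted_ad x c b')"
      using sb x step.hyps b'L by (simp add: shifted_ad_linear)
    also have "\<dots> \<in> split_part x C A"
      by (rule split_part_add[OF A x sb(1) split_part.base[OF b'(2)]])
    finally have "y - b' \<in> split_part x C A"
      using step.hyps b'L by (intro split_part.step[of "y - b'" c]) (simp_all add: carrier_closed)
    moreover have "y = (y - b') + b'" by simp
    ultimately show ?case using b' by blast
  qed
  with that show thesis by blast
qed

text \<open>
  A subalgebra \<open>U\<close> above the complement \<open>S\<close> is determined by \<open>U \<inter> B\<close>. This is an ideal of
  \<open>L = S + B\<close>, because \<open>S\<close> normalises it and \<open>B\<close> maps it into \<open>A\<close>, so irreducibility of \<open>B / A\<close>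
  leaves two possibilities.
\<close>
lemma complement_maximal_subalgebra:
  assumes AB: "chief_factor A B" and S: "subalgebra S" and int: "S \<inter> B = A"
    and sum: "\<And>y. y \<in> L \<Longrightarrow> \<exists>s b. s \<in> S \<and> b \<in> B \<and> y = s + b"
    and abelian: "\<And>b b'. \<lbrakk>b \<in> B; b' \<in> B\<rbrakk> \<Longrightarrow> bracket b b' \<in> A"
  shows "maximal_subalgebra S"
  unfolding maximal_subalgebra_def
proof (intro conjI allI impI)
  note B = chief_factorD(2)[OF AB]
  show "subalgebra S" by (rule S)
  show "S \<noteq> L"
    using int chief_factorD(3,4)[OF AB] lie_idealD(2)[OF B] by blast
  fix U assume U: "subalgebra U \<and> S \<subseteq> U"
  then have subU: "subspace U" "U \<subseteq> L" "\<And>x y. \<lbrakk>x \<in> U; y \<in> U\<rbrakk> \<Longrightarrow> bracket x y \<in> U"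
    by (auto simp: subalgebra_def)
  have "lie_ideal (U \<inter> B)"
    unfolding lie_ideal_def
  proof (intro conjI ballI)
    show "subspace (U \<inter> B)" using subU lie_idealD(1)[OF B] by (simp add: subspace_inter)
    show "U \<inter> B \<subseteq> L" using subU by blast
    fix y u assume y: "y \<in> L" and u: "u \<in> U \<inter> B"
    obtain s b where sb: "s \<in> S" "b \<in> B" "y = s + b" using sum[OF y] by blast
    have L: "s \<in> L" "b \<in> L" "u \<in> L" using sb u U subU lie_idealD(2)[OF B] by auto
    have "bracket s u \<in> U" using subU(3) sb u U by blast
    moreover have "bracket b u \<in> U" using abelian[of b u] sb u int U by blast
    ultimately have "bracket y u \<in> U"
      using L sb subU by (simp add: bracket_add_left subspace_add)
    then show "bracket y u \<in> U \<inter> B" using lie_idealD(3)[OF B y] u by blast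
  qed
  then consider "U \<inter> B = A" | "U \<inter> B = B"
    using chief_factorD(5)[OF AB, of "U \<inter> B"] U int by blast
  then show "U = S \<or> U = L"
  proof cases
    case 1
    have "u \<in> S" if u: "u \<in> U" for u
    proof -
      obtain s b where sb: "s \<in> S" "b \<in> B" "u = s + b" using sum[of u] u subU by blast
      then have "b \<in> U" using subspace_diff[OF subU(1) u, of s] U by auto
      then have "b \<in> S" using 1 sb int by blast
      then show ?thesis using sb S by (auto simp: subalgebra_def intro: subspace_add)
    qed
    then show ?thesis using U by blast
  next
    case 2
    have "y \<in> U" if "y \<in> L" for y
      using sum[OF that] 2 U subU(1) subspace_add[of U] by blast
    then show ?thesis using subU(2) by blast
  qed
qed

lemma complement_codim:
  assumes AB: "chief_factor A B" and S: "subalgebra S" and int: "S \<inter> B = A"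
    and dim: "dim B > Suc (dim A)"
  shows "dim L - dim S > 1"
proof (rule ccontr)
  assume "\<not> ?thesis"
  then have le: "dim L \<le> Suc (dim S)" by simp
  note A = chief_factorD(1)[OF AB] and B = chief_factorD(2)[OF AB]
  have sub: "subspace S" "S \<subseteq> L" using S by (auto simp: subalgebra_def)
  obtain b where b: "b \<in> B" "b \<notin> A" using chief_factorD(3,4)[OF AB] by blast
  then have bS: "b \<notin> S" "b \<in> L" using int lie_idealD(2)[OF B] by auto
  have "span (insert b S) = L"
    using le dim_span_insert[OF sub bS(1)] bS sub
    by (intro subspace_eq_of_dim subspace_insert subspace_carrier) auto
  \<comment> \<open>If \<open>S\<close> had codimension at most 1, then intersecting \<open>L = S + F b\<close> with \<open>B\<close> gives \<open>B = A + F b\<close>.\<close>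
  have "B \<subseteq> span (insert b A)"
  proof
    fix v assume v: "v \<in> B"
    then have "v \<in> span (insert b S)"
      using \<open>span (insert b S) = L\<close> lie_idealD(2)[OF B] by simp
    then obtain k where k: "v - k *s b \<in> span S" by (auto simp: span_insert)
    then have "v - k *s b \<in> S" using sub by (metis span_eq_iff)
    moreover have "v - k *s b \<in> B"
      using v b lie_idealD(1)[OF B] by (intro subspace_diff subspace_scale)
    ultimately have "v - k *s b \<in> span A" using int by (auto intro: span_base)
    then show "v \<in> span (insert b A)" by (auto simp: span_insert)
  qed
  moreover have "span (insert b A) \<subseteq> L"
    using bS lie_idealD(2)[OF A] by (intro subspace_insert subspace_carrier) auto
  ultimately have "dim B \<le> dim (span (insert b A))"
    by (intro dim_mono lie_idealD(1)[OF B]) auto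
  also have "\<dots> = Suc (dim A)"
    using b lie_idealD[OF A] by (intro dim_span_insert) auto
  finally show False using dim by simp
qed

text \<open>
  Otherwise \<open>split_part x C A\<close> would complement \<open>B\<close> modulo \<open>A\<close> and be a member of \<open>D_set\<close> that does
  not contain \<open>B\<close>. Membership in \<open>G_set\<close> comes for free, with \<open>x\<close> itself as the witness.
\<close>
lemma chief_factor_subset_split_part:
  assumes sol: "solvable" and AB: "chief_factor A B" and dim: "dim B > Suc (dim A)"
    and below: "\<And>M. M \<in> D_set \<Longrightarrow> B \<subseteq> M"
    and J: "lie_ideal J" and x: "x \<in> J"
    and comm: "\<And>u v b. \<lbrakk>u \<in> J; v \<in> J; b \<in> B\<rbrakk> \<Longrightarrow> bracket (bracket u v) b \<in> A"
    and C: "0 \<in> C" "\<And>c d. \<lbrakk>c \<in> C; d \<in> C\<rbrakk> \<Longrightarrow> c + d \<in> C"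
    and split: "L \<subseteq> split_part x C B"
  shows "B \<subseteq> split_part x C A"
proof (rule ccontr)
  assume nsub: "\<not> ?thesis"
  note A = chief_factorD(1)[OF AB] and B = chief_factorD(2)[OF AB]
  define S where "S = split_part x C A"
  have xL: "x \<in> L" using lie_idealD(2)[OF J x] .
  have "lie_ideal (S \<inter> B)"
    unfolding S_def using split_part_Int_ideal[OF A B J x comm] .
  moreover have "A \<subseteq> S" by (auto simp: S_def intro: split_part.base)
  ultimately have int: "S \<inter> B = A"
    using chief_factorD(5)[OF AB, of "S \<inter> B"] chief_factorD(3)[OF AB] nsub
    by (auto simp: S_def)
  have S: "subalgebra S" unfolding S_def by (rule subalgebra_split_part[OF A xL C(2)])
  have sum: "\<exists>s b. s \<in> S \<and> b \<in> B \<and> y = s + b" if "y \<in> L" for y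
    using split_part_complement[OF A B chief_factorD(3)[OF AB] xL int[unfolded S_def], of y]
      that split by (metis S_def subsetD)
  have "maximal_subalgebra S"
    using complement_maximal_subalgebra[OF AB S int sum chief_factor_abelian[OF sol AB]] .
  moreover have "engel_subalgebra x \<subseteq> S"
    unfolding S_def by (rule engel_subset_split_part[OF A xL C(1)])
  ultimately have "S \<in> D_set"
    using complement_codim[OF AB S int dim] xL by (auto simp: D_set_def G_set_def H_set_def)
  then show False using below nsub by (auto simp: S_def)
qed

section \<open>Simultaneous eigenvectors\<close>

text \<open>
  Applying the factors \<open>ad x - c\<close> to \<open>v\<close> one after the other, the last vector outside \<open>W\<close> is an
  eigenvector modulo \<open>W\<close>.
\<close>
lemma eigenvector_in_split_part:
  assumes "v \<in> split_part x C W" "v \<in> V" "v \<notin> W"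
    and "\<And>w c. w \<in> V \<Longrightarrow> shifted_ad x c w \<in> V"
  obtains w c where "w \<in> V" "w \<notin> W" "c \<in> C" "shifted_ad x c w \<in> W"
proof -
  have "\<exists>w c. w \<in> V \<and> w \<notin> W \<and> c \<in> C \<and> shifted_ad x c w \<in> W"
    using assms(1-3) by induction (use assms(4) in blast)+
  with that show thesis by blast
qed

text \<open>
  Choose \<open>V / W\<close> of least dimension among the nonzero \<open>J\<close>-stable subspaces of \<open>B / W\<close>. Eigenspaces of
  an element of \<open>J\<close> in \<open>V / W\<close> are \<open>J\<close>-stable by commutativity, so each element acts on \<open>V / W\<close> as a
  scalar. Then every line in \<open>V / W\<close> is stable, which forces dimension 1.
\<close>
lemma commuting_eigenline:
  assumes B: "subspace B" "B \<subseteq> L" "\<And>x b. \<lbrakk>x \<in> J; b \<in> B\<rbrakk> \<Longrightarrow> bracket x b \<in> B"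
    and W: "subspace W" "W \<subseteq> B" "W \<noteq> B" "\<And>x w. \<lbrakk>x \<in> J; w \<in> W\<rbrakk> \<Longrightarrow> bracket x w \<in> W"
    and J: "J \<subseteq> L"
    and comm: "\<And>u v b. \<lbrakk>u \<in> J; v \<in> J; b \<in> B\<rbrakk> \<Longrightarrow> bracket (bracket u v) b \<in> W"
    and split: "\<And>x. x \<in> J \<Longrightarrow> B \<subseteq> split_part x C W"
  obtains V where "subspace V" "W \<subseteq> V" "V \<subseteq> B" "dim V = Suc (dim W)"
    "\<And>x v. \<lbrakk>x \<in> J; v \<in> V\<rbrakk> \<Longrightarrow> bracket x v \<in> V"
    "\<And>x. x \<in> J \<Longrightarrow> \<exists>c\<in>C. \<forall>v\<in>V. shifted_ad x c v \<in> W"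
proof -
  define inv where "inv V \<longleftrightarrow> subspace V \<and> W \<subset> V \<and> V \<subseteq> B \<and>
    (\<forall>x\<in>J. \<forall>v\<in>V. bracket x v \<in> V)" for V
  have "inv B" using B W by (auto simp: inv_def)
  then obtain V where V: "inv V" and min: "\<And>U. inv U \<Longrightarrow> dim V \<le> dim U"
    using ex_has_least_nat[of inv B dim] by blast
  note VD = V[unfolded inv_def]
  have VL: "V \<subseteq> L" using VD B by blast
  have minimal: "U = V" if "inv U" "U \<subseteq> V" for U
    using that min[OF that(1)] VL VD by (intro subspace_eq_of_dim) (auto simp: inv_def)
  have scalar: "\<exists>c\<in>C. \<forall>v\<in>V. shifted_ad x c v \<in> W" if x: "x \<in> J" for x
  proof -
    have xL: "x \<in> L" using x J by blast
    obtain v where v: "v \<in> V" "v \<notin> W" using VD by blast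
    then have "v \<in> split_part x C W" using split[OF x] VD by blast
    moreover have "shifted_ad x c w \<in> V" if "w \<in> V" for w c
      using that VD x by (intro shifted_ad_closed) auto
    ultimately obtain w c where w: "w \<in> V" "w \<notin> W" "c \<in> C" "shifted_ad x c w \<in> W"
      using eigenvector_in_split_part v by blast
    define U where "U = {u \<in> V. shifted_ad x c u \<in> W}"
    have "inv U"
      unfolding inv_def
    proof (intro conjI ballI)
      show "subspace U"
        unfolding subspace_def
      proof (intro conjI ballI allI)
        show "0 \<in> U"
          using VD W(1) xL
          by (simp add: U_def shifted_ad_def bracket_zero_right subspace_0)
        show "u + u' \<in> U" if "u \<in> U" "u' \<in> U" for u u'
          using that VD W(1) xL VL
          by (auto simp: U_def shifted_ad_linear subset_iff intro: subspace_add)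
        show "d *s u \<in> U" if "u \<in> U" for d u
          using that VD W(1) xL VL
          by (auto simp: U_def shifted_ad_linear subset_iff intro: subspace_scale)
      qed
      have "W \<subseteq> U"
        using VD shifted_ad_closed[OF W(1,4), OF x] by (auto simp: U_def)
      then show "W \<subset> U" using w by (auto simp: U_def)
      show "U \<subseteq> B" using VD by (auto simp: U_def)
      fix y u assume y: "y \<in> J" and u: "u \<in> U"
      then have uV: "u \<in> V" "shifted_ad x c u \<in> W" by (auto simp: U_def)
      have "shifted_ad x c (bracket y u) = bracket y (shifted_ad x c u) + bracket (bracket x y) u"
        using xL y J uV VL by (intro shifted_ad_bracket_right) auto
      moreover have "bracket (bracket x y) u \<in> W" using comm x y uV VD by blast
      ultimately have "shifted_ad x c (bracket y u) \<in> W"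
        using W y uV by (simp add: subspace_add)
      then show "bracket y u \<in> U" using VD y uV by (simp add: U_def)
    qed
    then have "U = V" using minimal by (auto simp: U_def)
    then show ?thesis using w by (auto simp: U_def)
  qed
  obtain v where v: "v \<in> V" "v \<notin> W" using VD by blast
  define U where "U = span (insert v W)"
  have U: "subspace U" "insert v W \<subseteq> U" "U \<subseteq> V"
    using v VD subspace_insert[of V v W] by (auto simp: U_def span_base)
  have "bracket x u \<in> U" if x: "x \<in> J" and u: "u \<in> U" for x u
  proof -
    obtain c where c: "shifted_ad x c u \<in> W" using scalar[OF x] U u by blast
    have "bracket x u = shifted_ad x c u + c *s u" by (simp add: shifted_ad_def)
    then show ?thesis using c u U by (auto intro: subspace_add subspace_scale)
  qed
  then have "inv U" unfolding inv_def using U v VD by auto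
  then have "V = U" using minimal U by blast
  then have "dim V = Suc (dim W)"
    unfolding U_def using dim_span_insert[of W v] v W B by auto
  then show thesis using that[of V] VD scalar by blast
qed

section \<open>Spectra of elements above a flag\<close>
lemma hyperplane_scalar:
  assumes V: "subspace V" "V \<subseteq> L" "\<And>v. v \<in> V \<Longrightarrow> bracket x v \<in> V"
    and W: "subspace W" "W \<subseteq> V" "\<And>w. w \<in> W \<Longrightarrow> bracket x w \<in> W"
    and dim: "dim V = Suc (dim W)" and x: "x \<in> L"
  obtains c where "\<And>v. v \<in> V \<Longrightarrow> shifted_ad x c v \<in> W"
proof -
  obtain e where e: "e \<in> V" "e \<notin> W" using dim W by (metis n_not_Suc_n subsetI subset_antisym)
  have "dim (span (insert e W)) = Suc (dim W)"
    using W V e by (intro dim_span_insert) auto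
  then have eV: "span (insert e W) = V"
    using dim V W e by (intro subspace_eq_of_dim subspace_insert) auto
  have decomp: "\<exists>k. v - k *s e \<in> W" if "v \<in> V" for v
    using that unfolding eV[symmetric] span_insert using W(1) by (auto simp: span_eq_iff[THEN iffD2])
  obtain c where c: "shifted_ad x c e \<in> W"
    using decomp[OF V(3)[OF e(1)]] by (auto simp: shifted_ad_def)
  have "shifted_ad x c v \<in> W" if v: "v \<in> V" for v
  proof -
    obtain k where k: "v - k *s e \<in> W" using decomp[OF v] by blast
    have L: "v \<in> L" "e \<in> L" using v e V by auto
    have "shifted_ad x c v = shifted_ad x c (v - k *s e) + k *s shifted_ad x c e"
      using L x by (simp add: shifted_ad_linear carrier_closed)
    moreover have "shifted_ad x c (v - k *s e) \<in> W"
      using shifted_ad_closed[OF W(1,3) k] .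
    ultimately show ?thesis using c W(1) by (simp add: subspace_add subspace_scale)
  qed
  with that show thesis by blast
qed

text \<open>
  \<open>x \<in> D\<close> maps \<open>L\<close> into \<open>D\<close>, so it has eigenvalue 0 on \<open>L / D\<close>; on each step of the flag it is a
  scalar.
\<close>
lemma flagged_split:
  assumes D: "lie_ideal D" and x: "x \<in> D" and W: "flagged D W"
  shows "L \<subseteq> split_part x UNIV W"
  using W
proof induction
  case top
  show ?case
  proof
    fix y assume y: "y \<in> L"
    have "shifted_ad x 0 y \<in> D"
      unfolding shifted_ad_zero using lie_ideal_bracket_left[OF D x y] .
    then show "y \<in> split_part x UNIV D"
      using y by (intro split_part.step[of y 0] split_part.base) auto
  qed
next
  case (step V W)
  note V = flagged_stable[OF D step.hyps(1)]
  have xL: "x \<in> L" "V \<subseteq> L" using V x lie_idealD(2)[OF D] by auto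
  obtain c where c: "\<And>v. v \<in> V \<Longrightarrow> shifted_ad x c v \<in> W"
    using hyperplane_scalar[of V x W, OF _ xL(2) _ step.hyps(2,3) _ step.hyps(5) xL(1)]
      V step.hyps(4) x by metis
  have "V \<subseteq> split_part x UNIV W"
    using c xL by (intro subset_split_part[of V c]) auto
  with step.IH show ?case using split_part_trans by blast
qed

text \<open>
  Scalars commute, so an element of \<open>[D, D]\<close> acts as 0 on each step of the flag, and hence nilpotently
  on \<open>L / W\<close>.
\<close>
lemma flagged_derived_split:
  assumes D: "lie_ideal D" and x: "x \<in> derived_ideal D" and W: "flagged D W"
  shows "L \<subseteq> split_part x {0} W"
  using W
proof induction
  case top
  show ?case
  proof
    fix y assume y: "y \<in> L"
    have "x \<in> D" using x derived_ideal_subset[OF D] by blast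
    then have "shifted_ad x 0 y \<in> D"
      unfolding shifted_ad_zero using lie_ideal_bracket_left[OF D _ y] by blast
    then show "y \<in> split_part x {0} D"
      using y by (intro split_part.step[of y 0] split_part.base) auto
  qed
next
  case (step V W)
  note V = flagged_stable[OF D step.hyps(1)]
  have DL: "D \<subseteq> L" "V \<subseteq> L" using V lie_idealD(2)[OF D] by auto
  have scalar: "\<exists>c. \<forall>v\<in>V. shifted_ad u c v \<in> W" if "u \<in> D" for u
    using hyperplane_scalar[of V u W, OF _ DL(2) _ step.hyps(2,3) _ step.hyps(5)]
      V step.hyps(4) that DL(1) by (metis subsetD)
  have "x \<in> span {bracket u u' | u u'. u \<in> D \<and> u' \<in> D}"
    using x by (simp add: derived_ideal_def)
  then have "x \<in> D \<and> (\<forall>v\<in>V. bracket x v \<in> W)"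
  proof (induction rule: span_induct_alt)
    case base
    show ?case
      using subspace_0[OF lie_idealD(1)[OF D]] DL subspace_0[OF step.hyps(2)]
      by (auto simp: bracket_zero_left)
  next
    case (step k z y)
    then obtain u u' where z: "z = bracket u u'" "u \<in> D" "u' \<in> D" by blast
    have zD: "z \<in> D" using z lie_idealD[OF D] by blast
    obtain c where c: "\<And>v. v \<in> V \<Longrightarrow> shifted_ad u c v \<in> W" using scalar[OF z(2)] by blast
    obtain c' where c': "\<And>v. v \<in> V \<Longrightarrow> shifted_ad u' c' v \<in> W" using scalar[OF z(3)] by blast
    have "bracket z v \<in> W" if v: "v \<in> V" for v
    proof -
      have L: "u \<in> L" "u' \<in> L" "v \<in> L" using z v DL by auto
      have V': "shifted_ad u' c' v \<in> V" "shifted_ad u c v \<in> V"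
        using V z v by (auto intro: shifted_ad_closed)
      \<comment> \<open>The bracket of \<open>u\<close> and \<open>u'\<close> acts as the commutator of \<open>ad u - c\<close> and \<open>ad u' - c'\<close>.\<close>
      have "bracket z v = shifted_ad u c (shifted_ad u' c' v) - shifted_ad u' c' (shifted_ad u c v)"
        using L bracket_derivation[OF L]
        by (simp add: z(1) shifted_ad_def bracket_diff_right bracket_scale_right bracket_closed
            carrier_closed scale_right_diff_distrib mult.commute)
      also have "\<dots> \<in> W"
        using c c' V' \<open>subspace W\<close> by (intro subspace_diff) auto
      finally show ?thesis .
    qed
    moreover have "k *s z + y \<in> D"
      using zD step.IH lie_idealD(1)[OF D] by (auto intro: subspace_add subspace_scale)
    ultimately show ?case
      using step.IH zD DL \<open>subspace W\<close>
      by (auto simp: bracket_add_left bracket_scale_left carrier_closed subset_iff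
          intro!: subspace_add subspace_scale)
  qed
  then have "V \<subseteq> split_part x {0} W"
    using DL by (intro subset_split_part[of V 0]) (auto simp: shifted_ad_zero)
  with step.IH show ?case using split_part_trans by blast
qed

section \<open>The action of the ideal on a chief factor\<close>
lemma lie_ideal_relative_centralizer:
  assumes A: "lie_ideal A" and B: "lie_ideal B" and J: "lie_ideal J"
  shows "lie_ideal {b \<in> B. \<forall>x\<in>J. bracket x b \<in> A}"
  unfolding lie_ideal_def
proof (intro conjI ballI)
  note L = lie_idealD(2)[OF B] lie_idealD(2)[OF J]
  show "subspace {b \<in> B. \<forall>x\<in>J. bracket x b \<in> A}"
    unfolding subspace_def
    using L by (auto simp: bracket_zero_right bracket_add_right bracket_scale_right
        subspace_0[OF lie_idealD(1)[OF A]] subspace_0[OF lie_idealD(1)[OF B]]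
        intro: subspace_add[OF lie_idealD(1)[OF A]] subspace_add[OF lie_idealD(1)[OF B]]
          subspace_scale[OF lie_idealD(1)[OF A]] subspace_scale[OF lie_idealD(1)[OF B]])
  show "{b \<in> B. \<forall>x\<in>J. bracket x b \<in> A} \<subseteq> L" using L by blast
  fix y b assume y: "y \<in> L" and b: "b \<in> {b \<in> B. \<forall>x\<in>J. bracket x b \<in> A}"
  have "bracket x (bracket y b) \<in> A" if x: "x \<in> J" for x
  proof -
    have "bracket x (bracket y b) = bracket (bracket x y) b + bracket y (bracket x b)"
      using x y b L by (intro bracket_derivation) auto
    moreover have "bracket (bracket x y) b \<in> A"
      using b lie_ideal_bracket_left[OF J x y] by blast
    moreover have "bracket y (bracket x b) \<in> A" using b x y lie_idealD(3)[OF A] by blast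
    ultimately show ?thesis by (simp add: subspace_add[OF lie_idealD(1)[OF A]])
  qed
  then show "bracket y b \<in> {b \<in> B. \<forall>x\<in>J. bracket x b \<in> A}"
    using b lie_idealD(3)[OF B y] by blast
qed

text \<open>
  Suppose not, and let \<open>J\<close> be the intersection of \<open>[D, D]\<close> with the last derived term for which that
  intersection still acts nontrivially on \<open>B / A\<close>. Then \<open>J\<close> acts by commuting operators. They are
  nilpotent by \<open>chief_factor_subset_split_part\<close> with \<open>C = {0}\<close>, because elements of \<open>[D, D]\<close> are
  nilpotent on \<open>L / B\<close>. So \<open>J\<close> kills a nonzero vector of \<open>B / A\<close>; as the killed vectors form an
  ideal of \<open>L\<close> modulo \<open>A\<close>, it kills everything.
\<close>
lemma derived_ideal_kills_chief_factor:
  assumes sol: "solvable" and AB: "chief_factor A B" and dim: "dim B > Suc (dim A)"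
    and below: "\<And>M. M \<in> D_set \<Longrightarrow> B \<subseteq> M"
    and D: "lie_ideal D" and flag: "flagged D B"
    and x: "x \<in> derived_ideal D" and b: "b \<in> B"
  shows "bracket x b \<in> A"
proof (rule ccontr)
  assume nA: "bracket x b \<notin> A"
  note A = chief_factorD(1)[OF AB] and B = chief_factorD(2)[OF AB]
  note D2 = lie_ideal_derived_ideal[OF D]
  define acts where "acts X \<longleftrightarrow> (\<exists>x\<in>X \<inter> derived_ideal D. \<exists>b\<in>B. bracket x b \<notin> A)" for X
  have "acts L" using x b nA lie_idealD(2)[OF D2] by (auto simp: acts_def)
  moreover have "\<not> acts {0}"
    using subspace_0[OF lie_idealD(1)[OF A]] lie_idealD(2)[OF B]
    by (auto simp: acts_def bracket_zero_left)
  ultimately obtain n where n: "acts (derived_series n)" "\<not> acts (derived_series (Suc n))"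
    using solvable_jump[OF sol, of acts] by blast
  define J where "J = derived_series n \<inter> derived_ideal D"
  have J: "lie_ideal J"
    unfolding J_def by (intro lie_ideal_Int lie_ideal_derived_series D2)
  have comm: "bracket (bracket u v) b \<in> A" if "u \<in> J" "v \<in> J" "b \<in> B" for u v b
  proof -
    have "bracket u v \<in> derived_series (Suc n)"
      unfolding derived_series_Suc_eq using that by (intro bracket_in_derived_ideal) (auto simp: J_def)
    moreover have "bracket u v \<in> derived_ideal D"
      using that lie_idealD[OF D2] by (auto simp: J_def)
    ultimately show ?thesis using n(2) that by (auto simp: acts_def)
  qed
  have split: "B \<subseteq> split_part x {0} A" if "x \<in> J" for x
  proof (rule chief_factor_subset_split_part[OF sol AB dim below J that comm])
    show "L \<subseteq> split_part x {0} B"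
      using that by (intro flagged_derived_split[OF D _ flag]) (auto simp: J_def)
  qed auto
  have JL: "J \<subseteq> L" using lie_idealD(2)[OF J] by blast
  obtain V where V: "subspace V" "A \<subseteq> V" "V \<subseteq> B" "dim V = Suc (dim A)"
    "\<And>x. x \<in> J \<Longrightarrow> \<exists>c\<in>{0}. \<forall>v\<in>V. shifted_ad x c v \<in> A"
    using commuting_eigenline[of B J A "{0}", OF lie_idealD(1)[OF B]]
      lie_idealD[OF A] lie_idealD[OF B] chief_factorD(3,4)[OF AB] JL comm split
    by (smt (verit) subset_iff)
  define Z where "Z = {b \<in> B. \<forall>x\<in>J. bracket x b \<in> A}"
  have "V \<subseteq> Z" using V by (auto simp: Z_def shifted_ad_zero)
  moreover have "V \<noteq> A" using V(4) by auto
  moreover have "lie_ideal Z" unfolding Z_def by (rule lie_ideal_relative_centralizer[OF A B J])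
  moreover have "Z \<subseteq> B" by (auto simp: Z_def)
  ultimately have "Z = B" using chief_factorD(5)[OF AB, of Z] V(2) by blast
  then show False using n(1) by (auto simp: acts_def Z_def J_def)
qed

text \<open>
  A chief factor of dimension 1 is itself a step. In a larger one, \<open>D\<close> acts by commuting operators with
  all eigenvalues in the field, so one dimension at a time can be split off above \<open>A\<close>.
\<close>
lemma flagged_chief_step:
  assumes sol: "solvable" and AB: "chief_factor A B"
    and below: "\<And>M. M \<in> D_set \<Longrightarrow> B \<subseteq> M"
    and D: "lie_ideal D" and flag: "flagged D B"
  shows "flagged D A"
proof -
  note A = chief_factorD(1)[OF AB] and B = chief_factorD(2)[OF AB]
  have DL: "D \<subseteq> L" "B \<subseteq> L" using lie_idealD(2)[OF D] lie_idealD(2)[OF B] by auto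
  have stable: "bracket x a \<in> A" if "x \<in> D" "a \<in> A" for x a
    using that DL lie_idealD(3)[OF A] by blast
  obtain b where b: "b \<in> B" "b \<notin> A" using chief_factorD(3,4)[OF AB] by blast
  have "Suc (dim A) \<le> dim B"
  proof -
    have "A \<subseteq> L" using DL chief_factorD(3)[OF AB] by blast
    then have "Suc (dim A) = dim (span (insert b A))"
      using dim_span_insert[OF lie_idealD(1)[OF A] _ b(2)] by simp
    also have "\<dots> \<le> dim B"
      using dim_mono[OF subspace_span lie_idealD(1)[OF B] DL(2)]
        subspace_insert[OF lie_idealD(1)[OF B] b(1) chief_factorD(3)[OF AB]] by blast
    finally show ?thesis .
  qed
  then consider "dim B = Suc (dim A)" | "dim B > Suc (dim A)" by linarith
  then show ?thesis
  proof cases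
    case 1
    show ?thesis
      by (rule flagged.step[OF flag lie_idealD(1)[OF A] chief_factorD(3)[OF AB] stable 1])
  next
    case 2
    have comm: "bracket (bracket u v) b \<in> A" if "u \<in> D" "v \<in> D" "b \<in> B" for u v b
      by (rule derived_ideal_kills_chief_factor[OF sol AB 2 below D flag
            bracket_in_derived_ideal[OF that(1,2)] that(3)])
    have split: "B \<subseteq> split_part x UNIV A" if "x \<in> D" for x
      by (rule chief_factor_subset_split_part[OF sol AB 2 below D that comm])
        (simp_all add: flagged_split[OF D that flag])
    have "flagged D W" if "subspace W" "A \<subseteq> W" "W \<subseteq> B"
        "\<And>x w. \<lbrakk>x \<in> D; w \<in> W\<rbrakk> \<Longrightarrow> bracket x w \<in> W" for W
      using that
    proof (induction "dim B - dim W" arbitrary: W rule: less_induct)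
      case less
      show ?case
      proof (cases "W = B")
        case True
        then show ?thesis using flag by simp
      next
        case False
        have B_stable: "bracket x b \<in> B" if "x \<in> D" "b \<in> B" for x b
          using that DL lie_idealD(3)[OF B] by blast
        have comm': "bracket (bracket u v) b \<in> W" if "u \<in> D" "v \<in> D" "b \<in> B" for u v b
          using comm[OF that] less.prems(2) by blast
        have split': "B \<subseteq> split_part x UNIV W" if "x \<in> D" for x
        proof
          fix b assume "b \<in> B"
          then have "b \<in> split_part x UNIV A" using split[OF that] by blast
          moreover have "A \<subseteq> split_part x UNIV W"
            using less.prems(2) split_part.base by blast
          ultimately show "b \<in> split_part x UNIV W" by (rule split_part_trans)
        qed
        obtain V where V: "subspace V" "W \<subseteq> V" "V \<subseteq> B" "dim V = Suc (dim W)"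
          "\<And>x v. \<lbrakk>x \<in> D; v \<in> V\<rbrakk> \<Longrightarrow> bracket x v \<in> V"
          by (rule commuting_eigenline[OF lie_idealD(1)[OF B] DL(2) B_stable less.prems(1,3) False
                less.prems(4) DL(1) comm' split']) (assumption | rule that | blast)+
        have "dim V \<le> dim B"
          by (rule dim_mono[OF V(1) lie_idealD(1)[OF B] DL(2) V(3)])
        then have "dim B - dim V < dim B - dim W" using V(4) by simp
        moreover have "A \<subseteq> V" using V(2) less.prems(2) by blast
        ultimately have "flagged D V" by (rule less.hyps[OF _ V(1) _ V(3,5)])
        then show ?thesis
          by (rule flagged.step[OF _ less.prems(1) V(2) less.prems(4) V(4)])
      qed
    qed
    from this[OF lie_idealD(1)[OF A] subset_refl chief_factorD(3)[OF AB] stable] show ?thesis .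
  qed
qed

lemma chief_factor_above:
  assumes A: "lie_ideal A" and D: "lie_ideal D" and AD: "A \<subset> D"
  obtains B where "chief_factor A B" "B \<subseteq> D"
proof -
  define P where "P B \<longleftrightarrow> lie_ideal B \<and> A \<subset> B \<and> B \<subseteq> D" for B
  have "P D" using D AD by (simp add: P_def)
  then obtain B where B: "P B" and min: "\<And>I. P I \<Longrightarrow> dim B \<le> dim I"
    using ex_has_least_nat[of P D dim] by blast
  have "I = A \<or> I = B" if I: "lie_ideal I" "A \<subseteq> I" "I \<subseteq> B" for I
  proof (cases "I = A")
    case False
    then have "P I" using I B by (auto simp: P_def)
    then have "I = B"
      using min I B lie_idealD[of B] lie_idealD(1)[OF I(1)]
      by (intro subspace_eq_of_dim) (auto simp: P_def)
    then show ?thesis ..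
  qed simp
  then show thesis using that[of B] A B by (auto simp: chief_factor_def P_def)
qed

lemma flagged_ideal:
  assumes sol: "solvable" and D: "lie_ideal D" and below: "\<And>M. M \<in> D_set \<Longrightarrow> D \<subseteq> M"
    and A: "lie_ideal A" "A \<subseteq> D"
  shows "flagged D A"
  using A
proof (induction "dim D - dim A" arbitrary: A rule: less_induct)
  case less
  show ?case
  proof (cases "A = D")
    case True
    then show ?thesis by (simp add: flagged.top)
  next
    case False
    then obtain B where B: "chief_factor A B" "B \<subseteq> D"
      using chief_factor_above[OF less.prems(1) D] less.prems(2) by blast
    note Bi = chief_factorD(2)[OF B(1)]
    have sub: "subspace A" "subspace B" "subspace D" "D \<subseteq> L"
      using less.prems(1) Bi D by (auto simp: lie_ideal_def)
    have "\<not> dim B \<le> dim A"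
      using subspace_eq_of_dim[of A B] sub B chief_factorD(3,4)[OF B(1)] by blast
    moreover have "dim B \<le> dim D" using dim_mono sub B by blast
    ultimately have "flagged D B" by (intro less.hyps Bi B(2)) linarith
    then show ?thesis
      using flagged_chief_step[OF sol B(1) _ D] below B(2) by blast
  qed
qed

section \<open>Supersolvability\<close>
lemma flagged_chain:
  assumes D: "lie_ideal D" and W: "flagged D W"
  shows "\<exists>n I. I 0 = W \<and> I n = D \<and> (\<forall>i\<le>n. subspace (I i) \<and> I i \<subseteq> D \<and>
    (\<forall>x\<in>D. \<forall>y\<in>I i. bracket x y \<in> I i) \<and> dim (I i) = dim W + i) \<and> (\<forall>i<n. I i \<subseteq> I (Suc i))"
  using W
proof induction
  case top
  show ?case
    by (rule exI[of _ 0], rule exI[of _ "\<lambda>_. D"]) (use lie_idealD[OF D] in auto)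
next
  case (step V W)
  then obtain n I where I: "I 0 = V" "I n = D" "\<forall>i\<le>n. subspace (I i) \<and> I i \<subseteq> D \<and>
    (\<forall>x\<in>D. \<forall>y\<in>I i. bracket x y \<in> I i) \<and> dim (I i) = dim V + i" "\<forall>i<n. I i \<subseteq> I (Suc i)"
    by blast
  have "W \<subseteq> D" using step.hyps flagged_stable[OF D step.hyps(1)] by blast
  with I step.hyps show ?case
    by (intro exI[of _ "Suc n"] exI[of _ "case_nat W I"]) (auto split: nat.split)
qed

lemma supersolvable_of_subset_D_set:
  assumes sol: "solvable" and D: "lie_ideal D" and below: "\<And>M. M \<in> D_set \<Longrightarrow> D \<subseteq> M"
  shows "lie_algebra.supersolvable scale D bracket"
proof -
  interpret D: lie_algebra scale D bracket by (rule lie_algebra_lie_ideal[OF D])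
  have "{0} \<subseteq> D" using D.carrier_closed by simp
  then have "flagged D {0}"
    using flagged_ideal[OF sol D below lie_ideal_zero] by blast
  moreover have "dim {0} = 0" using dim_span_eq_card_independent[OF independent_empty] by simp
  ultimately show ?thesis
    using flagged_chain[OF D, of "{0}"] by (simp add: D.supersolvable_def D.lie_ideal_def)
qed

text \<open>
  \<open>H_inter\<close> is an intersection over the larger family \<open>H_set\<close>, so \<open>eta\<close> lies in all members of \<open>D_set\<close>
  as well.
\<close>
lemma supersolvable_delta_eta:
  assumes "solvable"
  shows "lie_algebra.supersolvable scale delta bracket"
    "lie_algebra.supersolvable scale eta bracket"
proof -
  have "delta \<subseteq> D_inter" "eta \<subseteq> H_inter"
    unfolding delta_def eta_def
    by (intro core_greatest subspace_D_inter subspace_H_inter)+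
  then have "delta \<subseteq> M" "eta \<subseteq> M" if "M \<in> D_set" for M
    using that by (auto simp: D_inter_def H_inter_def D_set_def split: if_splits)
  then show "lie_algebra.supersolvable scale delta bracket"
    "lie_algebra.supersolvable scale eta bracket"
    by (auto intro!: supersolvable_of_subset_D_set assms lie_ideal_delta lie_ideal_eta)
qed

end

theorem proposition3p9:
  fixes scale :: "'f::field \<Rightarrow> 'v::ab_group_add \<Rightarrow> 'v"
    and L :: "'v set"
    and bracket :: "'v \<Rightarrow> 'v \<Rightarrow> 'v"
  assumes "finite_dimensional_lie_algebra scale L bracket"
    and "lie_algebra.solvable scale L bracket"
  shows "lie_algebra.supersolvable scale (lie_algebra.delta scale L bracket) bracket \<and>
         lie_algebra.supersolvable scale (lie_algebra.eta scale L bracket) bracket"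
proof -
  interpret finite_dimensional_lie_algebra scale L bracket by (rule assms(1))
  show ?thesis using supersolvable_delta_eta[OF assms(2)] by blast
qed

end
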